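(* Let $\mu_1,\mu_2,\mu_3,\mu_4$ be nonzero real numbers with $\mu_2=\mu_4$. Then there is at least one kite configuration (critical point of $V$) such that $\theta_1=0$, $\theta_3=\pi$ and the vortices are ordered $v_1<v_2<v_3<v_4$ counterclockwise around the circle. Additionally, define the rational expressions (for $\mu_2\neq-2$) $$a=\tfrac{1}{2+\mu_2}(6\mu_3-15\mu_2-4),\qquad b=\tfrac{1}{2+\mu_2}(4\mu_3+15\mu_2-6),\qquad c=\tfrac{1}{2+\mu_2}(-\mu_2-2\mu_3),$$ $$\Delta=a^2b^2-4b^3-4a^3c+18abc-27c^2.$$ Then, counting kite configurations with $\theta_1=0$, $\theta_3=\pi$ and this ordering: 1. There are three kite configurations for parameter sets $(\mu_1,\mu_2,\mu_3,\mu_4)$ that are nonzero scalar multiples of vectors $(1,\mu_2,\mu_3,\mu_2)$ where $(\mu_2,\mu_3)$ belongs to $\{(\mu_2,\mu_3): c<0,\ b>0,\ \Delta>0,\ ab-9c<0\}$. 2. There are two kite configurations for parameter sets that are nonzero scalar multiples of vectors $(1,\mu_2,\mu_3,\mu_2)$ where $(\mu_2,\mu_3)$ is in the union of the sets: (a) $\{(\mu_2,\mu_3): c>0\}$; (b) $\{(\mu_2,\mu_3): c=0$ and ($\mu_2<-2$ or $\mu_2>6/13$)$\}$; (c) $\{(\mu_2,\mu_3): \mu_2=-2$ and $-\tfrac{13}{3}<\mu_3<1\}$; (d) $\{(\mu_2,\mu_3): \Delta=0$ and $ab-9c<0\}$. 3. There is only one kite configuration for any other parameter sets that are nonzero scalar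 multiples of vectors $(1,\mu_2,\mu_3,\mu_2)$.
   Context: The $(1+4)$-vortex problem: a dominant vortex of circulation $1$ is at the origin, and four infinitesimal vortices $v_1,v_2,v_3,v_4$ with circulation parameters $\mu_i\in\mathbb{R}\setminus\{0\}$ lie on the unit circle, $v_i$ being at the point with polar coordinates $(1,\theta_i)$. Vortices do not collide, so the angles $\theta_i$ are pairwise distinct modulo $2\pi$. Define $$V(\theta)=-\sum_{1\le i<j\le 4}\mu_i\mu_j\left[\cos(\theta_i-\theta_j)+\tfrac12\log\bigl(2-2\cos(\theta_i-\theta_j)\bigr)\right].$$ A configuration of the $(1+4)$-vortex problem with circulation parameters $(\mu_1,\dots,\mu_4)$ means a critical point $\theta=(\theta_1,\dots,\theta_4)$ of $V$. A kite configuration with $\theta_1=0$, $\theta_3=\pi$ and counterclockwise ordering $v_1<v_2<v_3<v_4$ is a critical point of $V$ of the form $\theta=(0,\theta_2,\pi,-\theta_2)$ with $\theta_2\in(0,\pi)$; distinct such configurations correspond to distinct values of $\theta_2$. In the sets above, conditions involving $a,b,c,\Delta$ are understood to require $\mu_2\neq-2$, and in items 1–3 the symbols $\mu_2,\mu_3$ denote the second and third coordinates after rescaling the parameter vector so that its first coordinate is $1$. *)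

theory Defs
  imports "HOL-Analysis.Analysis" "HOL-Library.Real_Mod"
begin

(* Pairs are indexed by naturals because the order of the index type 4 is not the
   intended one: there the numeral 4 equals 0 and is the least element. *)
definition V :: "real ^ 4 \<Rightarrow> real ^ 4 \<Rightarrow> real" where
  "V \<mu> \<theta> = - (\<Sum>(i, j) \<in> {(i :: nat, j :: nat). 1 \<le> i \<and> i < j \<and> j \<le> 4}.
      \<mu> $ of_nat i * \<mu> $ of_nat j *
        (cos (\<theta> $ of_nat i - \<theta> $ of_nat j)
          + 1/2 * ln (2 - 2 * cos (\<theta> $ of_nat i - \<theta> $ of_nat j))))"

definition critical_point :: "('a::real_normed_vector \<Rightarrow> real) \<Rightarrow> 'a \<Rightarrow> bool" where
  "critical_point f x \<longleftrightarrow> (f has_derivative (\<lambda>_. 0)) (at x)"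

definition collision_free :: "real ^ 4 \<Rightarrow> bool" where
  "collision_free \<theta> \<longleftrightarrow> (\<forall>i j. i \<noteq> j \<longrightarrow> \<not> [\<theta> $ i = \<theta> $ j] (rmod (2 * pi)))"

definition configuration :: "real ^ 4 \<Rightarrow> real ^ 4 \<Rightarrow> bool" where
  "configuration \<mu> \<theta> \<longleftrightarrow> collision_free \<theta> \<and> critical_point (V \<mu>) \<theta>"

definition kite_configurations :: "real ^ 4 \<Rightarrow> (real ^ 4) set" where
  "kite_configurations \<mu> =
     {\<theta>. configuration \<mu> \<theta> \<and> (\<exists>t. 0 < t \<and> t < pi \<and> \<theta> = vector [0, t, pi, - t])}"

definition coeff_a :: "real \<Rightarrow> real \<Rightarrow> real" where
  "coeff_a \<mu>\<^sub>2 \<mu>\<^sub>3 = 1 / (2 + \<mu>\<^sub>2) * (6 * \<mu>\<^sub>3 - 15 * \<mu>\<^sub>2 - 4)"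

definition coeff_b :: "real \<Rightarrow> real \<Rightarrow> real" where
  "coeff_b \<mu>\<^sub>2 \<mu>\<^sub>3 = 1 / (2 + \<mu>\<^sub>2) * (4 * \<mu>\<^sub>3 + 15 * \<mu>\<^sub>2 - 6)"

definition coeff_c :: "real \<Rightarrow> real \<Rightarrow> real" where
  "coeff_c \<mu>\<^sub>2 \<mu>\<^sub>3 = 1 / (2 + \<mu>\<^sub>2) * (- \<mu>\<^sub>2 - 2 * \<mu>\<^sub>3)"

definition Delta :: "real \<Rightarrow> real \<Rightarrow> real" where
  "Delta \<mu>\<^sub>2 \<mu>\<^sub>3 =
    (let a = coeff_a \<mu>\<^sub>2 \<mu>\<^sub>3; b = coeff_b \<mu>\<^sub>2 \<mu>\<^sub>3; c = coeff_c \<mu>\<^sub>2 \<mu>\<^sub>3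
     in a\<^sup>2 * b\<^sup>2 - 4 * b ^ 3 - 4 * a ^ 3 * c + 18 * a * b * c - 27 * c\<^sup>2)"

definition three_kites_region :: "(real \<times> real) set" where
  "three_kites_region =
     {(\<mu>\<^sub>2, \<mu>\<^sub>3). \<mu>\<^sub>2 \<noteq> -2 \<and> coeff_c \<mu>\<^sub>2 \<mu>\<^sub>3 < 0 \<and> coeff_b \<mu>\<^sub>2 \<mu>\<^sub>3 > 0 \<and> Delta \<mu>\<^sub>2 \<mu>\<^sub>3 > 0 \<and>
        coeff_a \<mu>\<^sub>2 \<mu>\<^sub>3 * coeff_b \<mu>\<^sub>2 \<mu>\<^sub>3 - 9 * coeff_c \<mu>\<^sub>2 \<mu>\<^sub>3 < 0}"

definition two_kites_region :: "(real \<times> real) set" where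
  "two_kites_region =
     {(\<mu>\<^sub>2, \<mu>\<^sub>3). \<mu>\<^sub>2 \<noteq> -2 \<and> coeff_c \<mu>\<^sub>2 \<mu>\<^sub>3 > 0}
   \<union> {(\<mu>\<^sub>2, \<mu>\<^sub>3). \<mu>\<^sub>2 \<noteq> -2 \<and> coeff_c \<mu>\<^sub>2 \<mu>\<^sub>3 = 0 \<and> (\<mu>\<^sub>2 < -2 \<or> \<mu>\<^sub>2 > 6/13)}
   \<union> {(\<mu>\<^sub>2, \<mu>\<^sub>3). \<mu>\<^sub>2 = -2 \<and> -13/3 < \<mu>\<^sub>3 \<and> \<mu>\<^sub>3 < 1}
   \<union> {(\<mu>\<^sub>2, \<mu>\<^sub>3). \<mu>\<^sub>2 \<noteq> -2 \<and> Delta \<mu>\<^sub>2 \<mu>\<^sub>3 = 0 \<and>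
        coeff_a \<mu>\<^sub>2 \<mu>\<^sub>3 * coeff_b \<mu>\<^sub>2 \<mu>\<^sub>3 - 9 * coeff_c \<mu>\<^sub>2 \<mu>\<^sub>3 < 0}"

end

theory Submission
  imports Defs
begin

text \<open>
  A kite \<open>(0, t, pi, - t)\<close> is invariant, up to exchanging the second and the fourth vortex, under
  reflection in its axis. Since these two have equal circulation, the gradient of \<open>V\<close>
  at a kite is a single number times a fixed covector, so that criticality is one equation in \<open>t\<close>
  (\<open>critical_point_kite_iff\<close>). With \<open>x = (1 + cos t) / (1 - cos t)\<close>, the square of
  \<open>cot (t / 2)\<close>, the equation becomes a cubic in \<open>x\<close>, and \<open>x\<close> ranges over all positive
  numbers as \<open>t\<close> ranges over \<open>(0, pi)\<close> (\<open>force_balance_iff_kite_cubic\<close>). Dividing this cubic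
  by its leading coefficient \<open>2 + \<mu>\<^sub>2\<close> gives \<open>x ^ 3 + a * x\<^sup>2 + b * x + c\<close>, whose coefficients are those
  of the statement. Counting kites is therefore counting distinct positive roots, and
  rescaling the circulations only rescales the equation.

  For \<open>c < 0\<close> there is a positive root by continuity, and the other two roots, if real, have the same
  sign. The discriminant decides whether all three are real and distinct. The signs of \<open>b\<close> and
  \<open>a * b - 9 * c\<close> decide whether they are all positive, because distinct positive roots satisfy
  \<open>a * b < 9 * c\<close>, an inequality between elementary symmetric functions (\<open>card_positive_roots_cubic_neg\<close>). For \<open>c > 0\<close>
  the product of the roots is negative, and there are exactly two positive
  ones as soon as the cubic is negative somewhere on the positive axis; explicit
  values at \<open>1/3\<close> and \<open>3\<close> show that this always happens. For \<open>c = 0\<close> or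
  \<open>\<mu>\<^sub>2 = -2\<close> a root has moved to zero or to infinity and what is left has degree at most two. At least one
  positive root remains in every case.
\<close>

section \<open>Positive roots of quadratic and cubic polynomials\<close>

definition positive_roots :: "(real \<Rightarrow> real) \<Rightarrow> real set" where
  "positive_roots p = {x. 0 < x \<and> p x = 0}"

definition cubic_discriminant :: "real \<Rightarrow> real \<Rightarrow> real \<Rightarrow> real" where
  "cubic_discriminant a b c = a\<^sup>2 * b\<^sup>2 - 4 * b ^ 3 - 4 * a ^ 3 * c + 18 * a * b * c - 27 * c\<^sup>2"

lemma positive_roots_scaleI:
  assumes "\<And>x. x > 0 \<Longrightarrow> p x = r x * q x" "\<And>x. x > 0 \<Longrightarrow> r x \<noteq> 0"
  shows "positive_roots p = positive_roots q"
  using assms by (auto simp: positive_roots_def)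

lemma quadratic_real_roots:
  fixes p q :: real
  assumes "p\<^sup>2 \<ge> 4 * q"
  obtains \<alpha> \<beta> where "p = - (\<alpha> + \<beta>)" "q = \<alpha> * \<beta>"
proof
  define d where "d = sqrt (p\<^sup>2 - 4 * q)"
  have d: "d\<^sup>2 = p\<^sup>2 - 4 * q" using assms by (simp add: d_def)
  show "p = - ((- p + d) / 2 + (- p - d) / 2)" by (simp add: field_simps)
  show "q = (- p + d) / 2 * ((- p - d) / 2)"
    using d by (simp add: field_simps power2_eq_square)
qed

text \<open>Together with a sign at zero or at an intermediate point, this feeds the intermediate value
  theorem.\<close>

lemma cubic_positive_beyond:
  fixes a b c y :: real
  shows "\<exists>z>y. z ^ 3 + a * z\<^sup>2 + b * z + c > 0"
proof (intro exI conjI)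
  define z where "z = 1 + \<bar>a\<bar> + \<bar>b\<bar> + \<bar>c\<bar> + \<bar>y\<bar>"
  have z1: "z \<ge> 1" by (simp add: z_def)
  then have z2: "1 \<le> z\<^sup>2" "z \<le> z\<^sup>2" "0 < z\<^sup>2"
    using one_le_power[OF z1, of 2] self_le_power[OF z1, of 2] by simp_all
  have "- (a * z\<^sup>2) \<le> \<bar>a\<bar> * z\<^sup>2"
    using mult_right_mono[of "- a" "\<bar>a\<bar>" "z\<^sup>2"] by simp
  moreover have "- (b * z) \<le> \<bar>b\<bar> * z\<^sup>2"
  proof -
    have "- (b * z) \<le> \<bar>b\<bar> * z" using mult_right_mono[of "- b" "\<bar>b\<bar>" z] z1 by simp
    also have "\<dots> \<le> \<bar>b\<bar> * z\<^sup>2" using z2 by (intro mult_left_mono) auto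
    finally show ?thesis .
  qed
  moreover have "- c \<le> \<bar>c\<bar> * z\<^sup>2"
    using mult_left_mono[of 1 "z\<^sup>2" "\<bar>c\<bar>"] z2 by simp
  moreover have "\<bar>a\<bar> * z\<^sup>2 + \<bar>b\<bar> * z\<^sup>2 + \<bar>c\<bar> * z\<^sup>2 < z * z\<^sup>2"
  proof -
    have "\<bar>a\<bar> + \<bar>b\<bar> + \<bar>c\<bar> < z" unfolding z_def by linarith
    then have "(\<bar>a\<bar> + \<bar>b\<bar> + \<bar>c\<bar>) * z\<^sup>2 < z * z\<^sup>2"
      using z2 by (intro mult_strict_right_mono)
    then show ?thesis by (simp add: algebra_simps)
  qed
  ultimately show "z ^ 3 + a * z\<^sup>2 + b * z + c > 0"
    by (simp add: power3_eq_cube power2_eq_square algebra_simps)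
  show "z > y" by (simp add: z_def)
qed

lemma cubic_sign_change_root:
  fixes a b c y z :: real
  assumes "y < z"
    and "(y ^ 3 + a * y\<^sup>2 + b * y + c) * (z ^ 3 + a * z\<^sup>2 + b * z + c) < 0"
  obtains s where "y < s" "s < z" "s ^ 3 + a * s\<^sup>2 + b * s + c = 0"
proof -
  let ?f = "\<lambda>x. x ^ 3 + a * x\<^sup>2 + b * x + c"
  have cont: "\<forall>x. y \<le> x \<and> x \<le> z \<longrightarrow> isCont ?f x"
    by (auto intro!: continuous_intros)
  have "\<exists>s. y \<le> s \<and> s \<le> z \<and> ?f s = 0"
  proof (cases "?f y < 0")
    case True
    then have "?f z > 0" using assms(2) by (simp add: mult_less_0_iff)
    with True show ?thesis using IVT[of ?f y 0 z] cont assms(1) by auto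
  next
    case False
    then have "?f y > 0" "?f z < 0" using assms(2) by (auto simp: mult_less_0_iff)
    then show ?thesis using IVT2[of ?f z 0 y] cont assms(1) by auto
  qed
  then obtain s where s: "y \<le> s" "s \<le> z" "?f s = 0" by blast
  moreover have "s \<noteq> y" "s \<noteq> z" using s(3) assms(2) by auto
  ultimately show ?thesis using that[of s] by auto
qed

lemma cubic_factor_root:
  fixes a b c s x :: real
  assumes "s ^ 3 + a * s\<^sup>2 + b * s + c = 0"
  defines "p \<equiv> a + s" and "q \<equiv> b + (a + s) * s"
  shows "x ^ 3 + a * x\<^sup>2 + b * x + c = (x - s) * (x\<^sup>2 + p * x + q)"
    and "c = - q * s"
proof -
  show c: "c = - q * s"
    using assms(1) by (simp add: q_def power2_eq_square power3_eq_cube algebra_simps)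
  show "x ^ 3 + a * x\<^sup>2 + b * x + c = (x - s) * (x\<^sup>2 + p * x + q)"
    unfolding c p_def q_def by (simp add: power2_eq_square power3_eq_cube algebra_simps)
qed

lemma card_positive_roots_quadratic:
  fixes a b :: real
  defines "R \<equiv> positive_roots (\<lambda>x. x\<^sup>2 + a * x + b)"
  shows "b < 0 \<Longrightarrow> card R = 1"
    and "b = 0 \<Longrightarrow> a < 0 \<Longrightarrow> card R = 1"
    and "b > 0 \<Longrightarrow> a < 0 \<Longrightarrow> a\<^sup>2 > 4 * b \<Longrightarrow> card R = 2"
proof -
  have factored: "R = {x. 0 < x \<and> (x = \<alpha> \<or> x = \<beta>)}" if "a = - (\<alpha> + \<beta>)" "b = \<alpha> * \<beta>" for \<alpha> \<beta>
  proof -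
    have "x\<^sup>2 + a * x + b = (x - \<alpha>) * (x - \<beta>)" for x
      unfolding that by (simp add: power2_eq_square algebra_simps)
    then show ?thesis by (auto simp: R_def positive_roots_def)
  qed
  show "card R = 1" if "b < 0"
  proof -
    have "a\<^sup>2 \<ge> 4 * b" using that zero_le_power2[of a] by linarith
    then obtain \<alpha> \<beta> where r: "a = - (\<alpha> + \<beta>)" "b = \<alpha> * \<beta>" by (rule quadratic_real_roots)
    have "\<alpha> * \<beta> < 0" using that r by simp
    then have "R = {\<alpha>} \<or> R = {\<beta>}"
      unfolding factored[OF r] by (auto simp: mult_less_0_iff)
    then show ?thesis by auto
  qed
  show "card R = 1" if "b = 0" "a < 0"
  proof -
    have "R = {- a}" unfolding factored[of 0 "- a", simplified, OF that(1)] using that by auto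
    then show ?thesis by simp
  qed
  show "card R = 2" if "b > 0" "a < 0" "a\<^sup>2 > 4 * b"
  proof -
    have "a\<^sup>2 \<ge> 4 * b" using that by simp
    then obtain \<alpha> \<beta> where r: "a = - (\<alpha> + \<beta>)" "b = \<alpha> * \<beta>" by (rule quadratic_real_roots)
    have "\<alpha> * \<beta> > 0" "\<alpha> + \<beta> > 0" using that r by simp_all
    then have "\<alpha> > 0" "\<beta> > 0" by (auto simp: zero_less_mult_iff)
    moreover have "\<alpha> \<noteq> \<beta>" using that(3) unfolding r by (auto simp: power2_eq_square algebra_simps)
    ultimately have "R = {\<alpha>, \<beta>}" "card {\<alpha>, \<beta>} = 2" unfolding factored[OF r] by auto
    then show ?thesis by simp
  qed
qed

text \<open>The discriminant of \<open>(x - s) * (x\<^sup>2 + p * x + q)\<close> is the discriminant of the quadratic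
  factor times the square of its value at \<open>s\<close>, the resultant of the two factors.\<close>

lemma cubic_discriminant_factor:
  fixes p q s :: real
  shows "cubic_discriminant (p - s) (q - p * s) (- q * s) = (p\<^sup>2 - 4 * q) * (s\<^sup>2 + p * s + q)\<^sup>2"
  unfolding cubic_discriminant_def
  by (simp add: power2_eq_square power3_eq_cube algebra_simps)

text \<open>A negative constant coefficient forces a positive root \<open>s\<close>, and the complementary quadratic
  has positive constant coefficient, so its roots are both positive, both negative, or not real.
  If they are positive, then the three roots satisfy
  \<open>(\<alpha> + \<beta> + s) * (\<alpha> * \<beta> + \<beta> * s + s * \<alpha>) \<ge> 9 * \<alpha> * \<beta> * s\<close> with equality only for a triple
  root; this is how \<open>a * b - 9 * c\<close> separates a double root from a triple one. The same quantity
  tells a positive double root from a negative one.\<close>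

lemma card_positive_roots_cubic_neg:
  fixes a b c :: real
  assumes c: "c < 0"
  shows "card (positive_roots (\<lambda>x. x ^ 3 + a * x\<^sup>2 + b * x + c)) =
    (if b > 0 \<and> cubic_discriminant a b c > 0 \<and> a * b - 9 * c < 0 then 3
     else if cubic_discriminant a b c = 0 \<and> a * b - 9 * c < 0 then 2 else 1)"
    (is "card ?R = ?n")
proof -
  obtain z where z: "z > 0" "z ^ 3 + a * z\<^sup>2 + b * z + c > 0"
    using cubic_positive_beyond[of 0 a b c] by blast
  obtain s where s: "s > 0" "s ^ 3 + a * s\<^sup>2 + b * s + c = 0"
    using cubic_sign_change_root[of 0 z a b c] z c by (auto simp: mult_less_0_iff)
  define p where "p = a + s"
  define q where "q = b + p * s"
  have factor: "x ^ 3 + a * x\<^sup>2 + b * x + c = (x - s) * (x\<^sup>2 + p * x + q)" for x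
    using cubic_factor_root(1)[OF s(2)] by (simp add: p_def q_def)
  have abc: "a = p - s" "b = q - p * s" "c = - q * s"
    using cubic_factor_root(2)[OF s(2)] by (simp_all add: p_def q_def)
  have q: "q > 0" using c s(1) abc(3) by (simp add: zero_less_mult_iff)
  have disc: "cubic_discriminant a b c = (p\<^sup>2 - 4 * q) * (s\<^sup>2 + p * s + q)\<^sup>2"
    unfolding abc by (rule cubic_discriminant_factor)
  show ?thesis
  proof (cases "p < 0 \<and> p\<^sup>2 \<ge> 4 * q")
    case True
    then obtain \<alpha> \<beta> where r: "p = - (\<alpha> + \<beta>)" "q = \<alpha> * \<beta>"
      using quadratic_real_roots by blast
    have "\<alpha> * \<beta> > 0" "\<alpha> + \<beta> > 0" using True q r by simp_all
    then have pos: "\<alpha> > 0" "\<beta> > 0" by (auto simp: zero_less_mult_iff)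
    have "x\<^sup>2 + p * x + q = (x - \<alpha>) * (x - \<beta>)" for x
      unfolding r by (simp add: power2_eq_square algebra_simps)
    then have R: "?R = {s, \<alpha>, \<beta>}"
      unfolding positive_roots_def factor using pos s(1) by auto
    have D: "cubic_discriminant a b c = ((\<alpha> - \<beta>) * (s - \<alpha>) * (s - \<beta>))\<^sup>2"
      unfolding disc r by (simp add: power2_eq_square algebra_simps)
    have b: "b > 0" unfolding abc r using pos s(1) by (simp add: add_pos_pos algebra_simps)
    have gap: "a * b - 9 * c = - (s * (\<alpha> - \<beta>)\<^sup>2 + \<alpha> * (\<beta> - s)\<^sup>2 + \<beta> * (s - \<alpha>)\<^sup>2)"
      unfolding abc r by (simp add: power2_eq_square algebra_simps)
    have nn: "s * (\<alpha> - \<beta>)\<^sup>2 \<ge> 0" "\<alpha> * (\<beta> - s)\<^sup>2 \<ge> 0" "\<beta> * (s - \<alpha>)\<^sup>2 \<ge> 0"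
      using pos s(1) by simp_all
    have neg: "a * b - 9 * c < 0 \<longleftrightarrow> \<not> (s = \<alpha> \<and> \<alpha> = \<beta>)"
    proof
      assume "a * b - 9 * c < 0"
      then show "\<not> (s = \<alpha> \<and> \<alpha> = \<beta>)" unfolding gap by auto
    next
      assume "\<not> (s = \<alpha> \<and> \<alpha> = \<beta>)"
      then have "s * (\<alpha> - \<beta>)\<^sup>2 > 0 \<or> \<beta> * (s - \<alpha>)\<^sup>2 > 0" using pos s(1) by auto
      with nn show "a * b - 9 * c < 0" unfolding gap by linarith
    qed
    show ?thesis unfolding R neg D using b by (auto simp: card_insert_if)
  next
    case False
    have no_root: "x\<^sup>2 + p * x + q > 0" if "x > 0" for x
    proof (cases "p \<ge> 0")
      case True
      then show ?thesis using that q by (simp add: add_nonneg_pos)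
    next
      case False
      then have "p\<^sup>2 < 4 * q" using \<open>\<not> (p < 0 \<and> p\<^sup>2 \<ge> 4 * q)\<close> by simp
      moreover have "x\<^sup>2 + p * x + q = (x + p / 2)\<^sup>2 + (4 * q - p\<^sup>2) / 4"
        by (simp add: power2_eq_square field_simps)
      ultimately show ?thesis by (simp add: add_nonneg_pos)
    qed
    then have "?R = {s}" unfolding positive_roots_def factor using s(1) by force
    moreover have "a * b - 9 * c \<ge> 0" if "cubic_discriminant a b c = 0"
    proof -
      have "p\<^sup>2 = 4 * q" using that no_root[OF s(1)] unfolding disc by auto
      moreover from this have "p \<ge> 0" using False by auto
      moreover have "a * b - 9 * c = p * (s\<^sup>2 + p * s + q) - 2 * s * (p\<^sup>2 - 4 * q)"
        unfolding abc by (simp add: power2_eq_square algebra_simps)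
      ultimately show ?thesis using no_root[OF s(1)] by simp
    qed
    moreover have "\<not> (b > 0 \<and> cubic_discriminant a b c > 0 \<and> a * b - 9 * c < 0)"
    proof
      \<comment> \<open>Here \<open>b > 0\<close> and \<open>a * b < 9 * c < 0\<close> give \<open>a < 0\<close>, the alternating sign pattern of a
        cubic without negative roots.\<close>
      assume h: "b > 0 \<and> cubic_discriminant a b c > 0 \<and> a * b - 9 * c < 0"
      then have "p\<^sup>2 > 4 * q" unfolding disc by (auto simp: zero_less_mult_iff)
      then have p: "p \<ge> 0" using False by auto
      have "a * b < 0" using h c by linarith
      then have "p < s" using h by (simp add: abc(1) mult_less_0_iff)
      then have "p\<^sup>2 \<le> p * s" using p by (simp add: power2_eq_square mult_left_mono)
      then show False using h \<open>p\<^sup>2 > 4 * q\<close> q unfolding abc by linarith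
    qed
    ultimately show ?thesis by auto
  qed
qed

text \<open>The negative value at \<open>y\<close> gives one root on either side of \<open>y\<close>; the product of the three
  roots is \<open>- c\<close>, so the third one is negative.\<close>

lemma card_positive_roots_cubic_pos:
  fixes a b c y :: real
  assumes c: "c > 0" and y: "y > 0" "y ^ 3 + a * y\<^sup>2 + b * y + c < 0"
  shows "card (positive_roots (\<lambda>x. x ^ 3 + a * x\<^sup>2 + b * x + c)) = 2"
proof -
  obtain z where z: "z > y" "z ^ 3 + a * z\<^sup>2 + b * z + c > 0"
    using cubic_positive_beyond[of y a b c] by blast
  obtain s where s: "0 < s" "s < y" "s ^ 3 + a * s\<^sup>2 + b * s + c = 0"
    using cubic_sign_change_root[of 0 y a b c] y c by (auto simp: mult_less_0_iff)
  obtain t where t: "y < t" "t ^ 3 + a * t\<^sup>2 + b * t + c = 0"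
    using cubic_sign_change_root[of y z a b c] y z by (auto simp: mult_less_0_iff)
  define p where "p = a + s"
  define q where "q = b + p * s"
  have factor: "x ^ 3 + a * x\<^sup>2 + b * x + c = (x - s) * (x\<^sup>2 + p * x + q)" for x
    using cubic_factor_root(1)[OF s(3)] by (simp add: p_def q_def)
  have "c = - q * s"
    using cubic_factor_root(2)[OF s(3)] by (simp add: p_def q_def)
  then have "q < 0" using c s(1) by (simp add: zero_less_mult_iff mult_less_0_iff)
  moreover have qt: "q = - t * (t + p)"
  proof -
    have "t\<^sup>2 + p * t + q = 0" using t s(2) factor[of t] by simp
    then show ?thesis by (simp add: power2_eq_square algebra_simps)
  qed
  ultimately have "t + p > 0" using t(1) y(1) by (simp add: zero_less_mult_iff)
  moreover have "x\<^sup>2 + p * x + q = (x - t) * (x + (t + p))" for x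
    unfolding qt by (simp add: power2_eq_square algebra_simps)
  ultimately have "positive_roots (\<lambda>x. x ^ 3 + a * x\<^sup>2 + b * x + c) = {s, t}"
    unfolding positive_roots_def factor using s t y by auto
  then show ?thesis using s t by simp
qed

section \<open>Force balance on a kite\<close>

lemma vector_4:
  "(vector [w, x, y, z] :: ('a::zero) ^ 4) $ 1 = w"
  "(vector [w, x, y, z] :: ('a::zero) ^ 4) $ 2 = x"
  "(vector [w, x, y, z] :: ('a::zero) ^ 4) $ 3 = y"
  "(vector [w, x, y, z] :: ('a::zero) ^ 4) $ 4 = z"
  unfolding vector_def by simp_all

text \<open>The index set of \<open>V\<close> is a set of natural numbers; listing it turns every later sum over
  pairs into six explicit terms.\<close>

lemma index_pairs_4:
  "{(i :: nat, j :: nat). 1 \<le> i \<and> i < j \<and> j \<le> 4} = {(1, 2), (1, 3), (1, 4), (2, 3), (2, 4), (3, 4)}"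
  by auto

definition pair_potential :: "real \<Rightarrow> real" where
  "pair_potential d = cos d + 1/2 * ln (2 - 2 * cos d)"

text \<open>The negative of the derivative of \<^const>\<open>pair_potential\<close> away from collisions.\<close>

definition pair_force :: "real \<Rightarrow> real" where
  "pair_force d = sin d - sin d / (2 - 2 * cos d)"

lemma V_eq:
  "V \<mu> \<theta> = - (\<mu> $ 1 * \<mu> $ 2 * pair_potential (\<theta> $ 1 - \<theta> $ 2)
    + \<mu> $ 1 * \<mu> $ 3 * pair_potential (\<theta> $ 1 - \<theta> $ 3)
    + \<mu> $ 1 * \<mu> $ 4 * pair_potential (\<theta> $ 1 - \<theta> $ 4)
    + \<mu> $ 2 * \<mu> $ 3 * pair_potential (\<theta> $ 2 - \<theta> $ 3)
    + \<mu> $ 2 * \<mu> $ 4 * pair_potential (\<theta> $ 2 - \<theta> $ 4)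
    + \<mu> $ 3 * \<mu> $ 4 * pair_potential (\<theta> $ 3 - \<theta> $ 4))"
  unfolding V_def index_pairs_4 pair_potential_def by simp

lemma has_derivative_pair_potential:
  fixes \<theta> :: "real ^ 4"
  assumes "cos (\<theta> $ i - \<theta> $ j) \<noteq> 1"
  shows "((\<lambda>\<theta>. pair_potential (\<theta> $ i - \<theta> $ j)) has_derivative
    (\<lambda>h. - pair_force (\<theta> $ i - \<theta> $ j) * (h $ i - h $ j))) (at \<theta>)"
proof -
  let ?d = "\<theta> $ i - \<theta> $ j"
  have "cos ?d < 1" using assms cos_le_one[of ?d] by linarith
  then have "(pair_potential has_real_derivative - pair_force ?d) (at ?d)"
    unfolding pair_potential_def pair_force_def
    by (auto intro!: derivative_eq_intros simp: field_simps)
  then have "(pair_potential has_derivative (*) (- pair_force ?d)) (at ?d)"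
    by (rule has_field_derivative_imp_has_derivative)
  moreover have "((\<lambda>\<theta>. \<theta> $ i - \<theta> $ j) has_derivative (\<lambda>h. h $ i - h $ j)) (at \<theta>)"
    by (intro has_derivative_diff bounded_linear_imp_has_derivative bounded_linear_vec_nth)
  ultimately show ?thesis
    using has_derivative_compose by blast
qed

lemma cos_eq_1_rcong: "cos (x - y) = 1 \<longleftrightarrow> [x = y] (rmod (2 * pi))"
proof
  assume "cos (x - y) = 1"
  then obtain n :: int where "x - y = of_int n * 2 * pi" using cos_one_2pi_int by blast
  then show "[x = y] (rmod (2 * pi))"
    unfolding rcong_altdef by (auto intro!: exI[of _ "- n"] simp: algebra_simps)
next
  assume "[x = y] (rmod (2 * pi))"
  then obtain n :: int where "y = x + of_int n * (2 * pi)"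
    unfolding rcong_altdef by blast
  then show "cos (x - y) = 1"
    by (auto simp: cos_one_2pi_int intro!: exI[of _ "- n"])
qed

lemma has_derivative_V:
  assumes "collision_free \<theta>"
  shows "(V \<mu> has_derivative (\<lambda>h.
      \<mu> $ 1 * \<mu> $ 2 * pair_force (\<theta> $ 1 - \<theta> $ 2) * (h $ 1 - h $ 2)
    + \<mu> $ 1 * \<mu> $ 3 * pair_force (\<theta> $ 1 - \<theta> $ 3) * (h $ 1 - h $ 3)
    + \<mu> $ 1 * \<mu> $ 4 * pair_force (\<theta> $ 1 - \<theta> $ 4) * (h $ 1 - h $ 4)
    + \<mu> $ 2 * \<mu> $ 3 * pair_force (\<theta> $ 2 - \<theta> $ 3) * (h $ 2 - h $ 3)
    + \<mu> $ 2 * \<mu> $ 4 * pair_force (\<theta> $ 2 - \<theta> $ 4) * (h $ 2 - h $ 4)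
    + \<mu> $ 3 * \<mu> $ 4 * pair_force (\<theta> $ 3 - \<theta> $ 4) * (h $ 3 - h $ 4))) (at \<theta>)"
proof -
  have pair: "((\<lambda>\<theta>. m * pair_potential (\<theta> $ i - \<theta> $ j)) has_derivative
      (\<lambda>h. m * (- pair_force (\<theta> $ i - \<theta> $ j) * (h $ i - h $ j)))) (at \<theta>)"
    if "i \<noteq> j" for i j m
    using assms that by (intro has_derivative_mult_right has_derivative_pair_potential)
      (simp add: collision_free_def cos_eq_1_rcong)
  have "(V \<mu> has_derivative (\<lambda>h. - (
      \<mu> $ 1 * \<mu> $ 2 * (- pair_force (\<theta> $ 1 - \<theta> $ 2) * (h $ 1 - h $ 2))
    + \<mu> $ 1 * \<mu> $ 3 * (- pair_force (\<theta> $ 1 - \<theta> $ 3) * (h $ 1 - h $ 3))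
    + \<mu> $ 1 * \<mu> $ 4 * (- pair_force (\<theta> $ 1 - \<theta> $ 4) * (h $ 1 - h $ 4))
    + \<mu> $ 2 * \<mu> $ 3 * (- pair_force (\<theta> $ 2 - \<theta> $ 3) * (h $ 2 - h $ 3))
    + \<mu> $ 2 * \<mu> $ 4 * (- pair_force (\<theta> $ 2 - \<theta> $ 4) * (h $ 2 - h $ 4))
    + \<mu> $ 3 * \<mu> $ 4 * (- pair_force (\<theta> $ 3 - \<theta> $ 4) * (h $ 3 - h $ 4))))) (at \<theta>)"
    unfolding V_eq[abs_def] by (intro has_derivative_minus has_derivative_add pair) simp_all
  then show ?thesis
    by (rule has_derivative_eq_rhs) (simp add: fun_eq_iff)
qed

abbreviation kite :: "real \<Rightarrow> real ^ 4" where
  "kite t \<equiv> vector [0, t, pi, - t]"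

lemma collision_free_kite:
  assumes "0 < t" "t < pi"
  shows "collision_free (kite t)"
proof -
  have c: "cos t < 1" "- 1 < cos t"
    using cos_monotone_0_pi[of 0 t] cos_monotone_0_pi[of t pi] assms by auto
  have "(cos t)\<^sup>2 < 1" using c by (simp add: abs_square_less_1)
  then have c2: "cos t * cos t - sin t * sin t \<noteq> 1"
    using cos_double[of t] cos_double_cos[of t] by (simp add: power2_eq_square)
  have "cos (kite t $ i - kite t $ j) \<noteq> 1" if "i \<noteq> j" for i j
    using that exhaust_4[of i] exhaust_4[of j] c c2
    by (auto simp: vector_4 cos_diff cos_add)
  then show ?thesis unfolding collision_free_def cos_eq_1_rcong by blast
qed

lemma pair_force_minus: "pair_force (- d) = - pair_force d"
  by (simp add: pair_force_def)

text \<open>On a kite the force on the two vortices of the symmetry axis cancels, since \<^const>\<open>pair_force\<close> is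
  odd, and the forces on the other two are opposite. Hence the gradient of \<open>V\<close> is a multiple
  of a single covector and only one scalar equation remains.\<close>

lemma critical_point_kite_iff:
  assumes t: "0 < t" "t < pi" and \<mu>: "\<mu> $ 2 \<noteq> 0" "\<mu> $ 2 = \<mu> $ 4"
  shows "critical_point (V \<mu>) (kite t) \<longleftrightarrow>
    \<mu> $ 1 * pair_force t + \<mu> $ 3 * pair_force (t - pi) + \<mu> $ 2 * pair_force (2 * t) = 0"
    (is "_ \<longleftrightarrow> ?F = 0")
proof -
  have "pair_force (pi + t) = pair_force (t - pi)" "pair_force (- pi) = 0"
    by (simp_all add: pair_force_def sin_diff cos_diff)
  then have D: "(V \<mu> has_derivative (\<lambda>h. \<mu> $ 2 * ?F * (h $ 2 - h $ 4))) (at (kite t))"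
    by (intro has_derivative_eq_rhs[OF has_derivative_V[OF collision_free_kite[OF t]]])
       (simp add: vector_4 pair_force_minus \<mu>(2)[symmetric] fun_eq_iff algebra_simps)
  show ?thesis
  proof
    assume "critical_point (V \<mu>) (kite t)"
    then have "(\<lambda>h :: real ^ 4. \<mu> $ 2 * ?F * (h $ 2 - h $ 4)) = (\<lambda>_. 0)"
      unfolding critical_point_def using has_derivative_unique[OF D] by blast
    \<comment> \<open>Move the second vortex alone.\<close>
    from fun_cong[OF this, of "axis 2 1"] show "?F = 0" using \<mu>(1) by (simp add: axis_def)
  next
    assume "?F = 0"
    then show "critical_point (V \<mu>) (kite t)" using D unfolding critical_point_def by simp
  qed
qed

definition kite_cubic :: "real \<Rightarrow> real \<Rightarrow> real \<Rightarrow> real" where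
  "kite_cubic \<mu>\<^sub>2 \<mu>\<^sub>3 x = (2 + \<mu>\<^sub>2) * x ^ 3 + (6 * \<mu>\<^sub>3 - 15 * \<mu>\<^sub>2 - 4) * x\<^sup>2
    + (4 * \<mu>\<^sub>3 + 15 * \<mu>\<^sub>2 - 6) * x - (\<mu>\<^sub>2 + 2 * \<mu>\<^sub>3)"

text \<open>In terms of \<open>cos t\<close> the balance of forces is \<open>sin t\<close>, which does not vanish, times a rational
  function; the variable \<open>x\<close> places the two collisions \<open>t = pi\<close> and \<open>t = 0\<close> at zero and at
  infinity.\<close>

lemma force_balance_iff_kite_cubic:
  assumes t: "0 < t" "t < pi" and x: "x > 0" "cos t = (x - 1) / (x + 1)"
  shows "pair_force t + \<mu>\<^sub>3 * pair_force (t - pi) + \<mu>\<^sub>2 * pair_force (2 * t) = 0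
    \<longleftrightarrow> kite_cubic \<mu>\<^sub>2 \<mu>\<^sub>3 x = 0"
proof -
  have s: "sin t > 0" using t by (simp add: sin_gt_zero)
  have c: "1 - cos t = 2 / (x + 1)" "1 + cos t = 2 * x / (x + 1)"
    using x by (simp_all add: field_simps)
  have d: "2 - 2 * cos t = 4 / (x + 1)" "2 + 2 * cos t = 4 * x / (x + 1)"
    using x by (simp_all add: field_simps)
  have d2: "2 - 2 * cos (2 * t) = 16 * x / (x + 1)\<^sup>2"
  proof -
    have "2 - 2 * cos (2 * t) = 4 * ((1 - cos t) * (1 + cos t))"
      unfolding cos_double_cos by (simp add: algebra_simps power2_eq_square)
    then show ?thesis unfolding c by (simp add: power2_eq_square)
  qed
  have f1: "pair_force t = sin t * ((3 - x) / 4)"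
    unfolding pair_force_def d by (simp add: field_simps)
  have "pair_force (t - pi) = - sin t + sin t / (2 + 2 * cos t)"
    by (simp add: pair_force_def sin_diff cos_diff)
  also have "\<dots> = - sin t * ((3 * x - 1) / (4 * x))"
    unfolding d using x(1) by (simp add: field_simps)
  finally have f2: "pair_force (t - pi) = - sin t * ((3 * x - 1) / (4 * x))" .
  have f3: "pair_force (2 * t) = sin t * ((x - 1) / (x + 1) * ((14 * x - x\<^sup>2 - 1) / (8 * x)))"
  proof -
    have "pair_force (2 * t) = sin (2 * t) * (1 - (x + 1)\<^sup>2 / (16 * x))"
      unfolding pair_force_def d2 by (simp add: algebra_simps)
    also have "1 - (x + 1)\<^sup>2 / (16 * x) = (14 * x - x\<^sup>2 - 1) / (16 * x)"
      using x(1) by (simp add: field_simps power2_eq_square)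
    finally show ?thesis unfolding sin_double x(2) by simp
  qed
  have "(3 - x) / 4 = (3 - x) * (2 * x * (x + 1)) / (8 * x * (x + 1))"
    "(3 * x - 1) / (4 * x) = (3 * x - 1) * (2 * (x + 1)) / (8 * x * (x + 1))"
    "(x - 1) / (x + 1) * ((14 * x - x\<^sup>2 - 1) / (8 * x))
      = (x - 1) * (14 * x - x\<^sup>2 - 1) / (8 * x * (x + 1))"
    using x(1) by (simp_all add: divide_simps)
  then have "pair_force t + \<mu>\<^sub>3 * pair_force (t - pi) + \<mu>\<^sub>2 * pair_force (2 * t)
    = sin t * ((3 - x) * (2 * x * (x + 1)) - \<mu>\<^sub>3 * ((3 * x - 1) * (2 * (x + 1)))
        + \<mu>\<^sub>2 * ((x - 1) * (14 * x - x\<^sup>2 - 1))) / (8 * x * (x + 1))"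
    unfolding f1 f2 f3 by (simp only:) (simp add: add_divide_distrib diff_divide_distrib algebra_simps)
  also have "(3 - x) * (2 * x * (x + 1)) - \<mu>\<^sub>3 * ((3 * x - 1) * (2 * (x + 1)))
        + \<mu>\<^sub>2 * ((x - 1) * (14 * x - x\<^sup>2 - 1)) = - kite_cubic \<mu>\<^sub>2 \<mu>\<^sub>3 x"
    unfolding kite_cubic_def by (simp add: algebra_simps power2_eq_square power3_eq_cube)
  finally show ?thesis using s x(1) by simp
qed

section \<open>Kites as positive roots of a cubic\<close>

text \<open>The substitution \<open>x = (1 + cos t) / (1 - cos t)\<close>, the square of \<open>cot (t / 2)\<close>, maps
  \<open>(0, pi)\<close> bijectively onto the positive half-line, with inverse
  \<open>t = arccos ((x - 1) / (x + 1))\<close>.\<close>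

lemma kite_configurations_eq_image:
  assumes k: "k \<noteq> 0" and \<mu>\<^sub>2: "\<mu>\<^sub>2 \<noteq> 0"
  shows "kite_configurations (k *\<^sub>R vector [1, \<mu>\<^sub>2, \<mu>\<^sub>3, \<mu>\<^sub>2]) =
    (\<lambda>x. kite (arccos ((x - 1) / (x + 1)))) ` positive_roots (kite_cubic \<mu>\<^sub>2 \<mu>\<^sub>3)"
    (is "kite_configurations ?\<mu> = ?g ` _")
proof -
  have config: "configuration ?\<mu> (kite t) \<longleftrightarrow> kite_cubic \<mu>\<^sub>2 \<mu>\<^sub>3 x = 0"
    if "0 < t" "t < pi" "x > 0" "cos t = (x - 1) / (x + 1)" for t x
  proof -
    have "configuration ?\<mu> (kite t) \<longleftrightarrow> k * pair_force t + k * \<mu>\<^sub>3 * pair_force (t - pi)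
        + k * \<mu>\<^sub>2 * pair_force (2 * t) = 0"
      using critical_point_kite_iff[OF that(1,2), of ?\<mu>] collision_free_kite[OF that(1,2)] k \<mu>\<^sub>2
      by (simp add: configuration_def vector_4)
    also have "\<dots> \<longleftrightarrow> k * (pair_force t + \<mu>\<^sub>3 * pair_force (t - pi)
        + \<mu>\<^sub>2 * pair_force (2 * t)) = 0"
      by (simp only: distrib_left mult.assoc)
    finally show ?thesis using force_balance_iff_kite_cubic[OF that] k by simp
  qed
  show ?thesis
  proof (intro equalityI subsetI)
    fix \<theta> assume "\<theta> \<in> kite_configurations ?\<mu>"
    then obtain t where t: "0 < t" "t < pi" "\<theta> = kite t" "configuration ?\<mu> (kite t)"
      unfolding kite_configurations_def by auto
    have c: "cos t < 1" "- 1 < cos t"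
      using cos_monotone_0_pi[of 0 t] cos_monotone_0_pi[of t pi] t by auto
    define x where "x = (1 + cos t) / (1 - cos t)"
    have x: "x > 0" "cos t = (x - 1) / (x + 1)" using c by (simp_all add: x_def field_simps)
    have "\<theta> = ?g x" using t x(2)[symmetric] by (simp add: arccos_cos)
    then show "\<theta> \<in> ?g ` positive_roots (kite_cubic \<mu>\<^sub>2 \<mu>\<^sub>3)"
      using config[OF t(1,2) x] t(4) x(1) by (auto simp: positive_roots_def)
  next
    fix \<theta> assume "\<theta> \<in> ?g ` positive_roots (kite_cubic \<mu>\<^sub>2 \<mu>\<^sub>3)"
    then obtain x where x: "x > 0" "kite_cubic \<mu>\<^sub>2 \<mu>\<^sub>3 x = 0" "\<theta> = ?g x"
      by (auto simp: positive_roots_def)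
    have y: "- 1 < (x - 1) / (x + 1)" "(x - 1) / (x + 1) < 1"
      using x(1) by (simp_all add: field_simps)
    let ?t = "arccos ((x - 1) / (x + 1))"
    have t: "0 < ?t" "?t < pi" "cos ?t = (x - 1) / (x + 1)"
      using arccos_lt_bounded[OF y] y by (simp_all add: cos_arccos)
    show "\<theta> \<in> kite_configurations ?\<mu>"
      using config[OF t(1,2) x(1) t(3)] t(1,2) x(2,3) unfolding kite_configurations_def by blast
  qed
qed

lemma card_kite_configurations:
  assumes "k \<noteq> 0" "\<mu>\<^sub>2 \<noteq> 0"
  shows "card (kite_configurations (k *\<^sub>R vector [1, \<mu>\<^sub>2, \<mu>\<^sub>3, \<mu>\<^sub>2])) =
    card (positive_roots (kite_cubic \<mu>\<^sub>2 \<mu>\<^sub>3))"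
proof -
  have "inj_on (\<lambda>x. kite (arccos ((x - 1) / (x + 1)))) (positive_roots (kite_cubic \<mu>\<^sub>2 \<mu>\<^sub>3))"
  proof (rule inj_onI)
    fix x y :: real
    assume "x \<in> positive_roots (kite_cubic \<mu>\<^sub>2 \<mu>\<^sub>3)" "y \<in> positive_roots (kite_cubic \<mu>\<^sub>2 \<mu>\<^sub>3)"
      and eq: "kite (arccos ((x - 1) / (x + 1))) = kite (arccos ((y - 1) / (y + 1)))"
    then have pos: "x > 0" "y > 0" by (auto simp: positive_roots_def)
    have "arccos ((x - 1) / (x + 1)) = arccos ((y - 1) / (y + 1))"
      using arg_cong[OF eq, of "\<lambda>v. v $ 2"] by (simp add: vector_4)
    moreover have "\<bar>(x - 1) / (x + 1)\<bar> \<le> 1" "\<bar>(y - 1) / (y + 1)\<bar> \<le> 1"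
      using pos by (simp_all add: abs_le_iff field_simps)
    ultimately have "(x - 1) / (x + 1) = (y - 1) / (y + 1)" using arccos_eq_iff by blast
    then show "x = y" using pos by (simp add: field_simps)
  qed
  then show ?thesis unfolding kite_configurations_eq_image[OF assms] by (rule card_image)
qed

section \<open>Counting in the parameter plane\<close>

lemma kite_cubic_monic:
  assumes "\<mu>\<^sub>2 \<noteq> -2"
  shows "kite_cubic \<mu>\<^sub>2 \<mu>\<^sub>3 x =
    (2 + \<mu>\<^sub>2) * (x ^ 3 + coeff_a \<mu>\<^sub>2 \<mu>\<^sub>3 * x\<^sup>2 + coeff_b \<mu>\<^sub>2 \<mu>\<^sub>3 * x + coeff_c \<mu>\<^sub>2 \<mu>\<^sub>3)"
proof -
  have nz: "2 + \<mu>\<^sub>2 \<noteq> 0" using assms by linarith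
  have coeffs: "(2 + \<mu>\<^sub>2) * coeff_a \<mu>\<^sub>2 \<mu>\<^sub>3 = 6 * \<mu>\<^sub>3 - 15 * \<mu>\<^sub>2 - 4"
    "(2 + \<mu>\<^sub>2) * coeff_b \<mu>\<^sub>2 \<mu>\<^sub>3 = 4 * \<mu>\<^sub>3 + 15 * \<mu>\<^sub>2 - 6"
    "(2 + \<mu>\<^sub>2) * coeff_c \<mu>\<^sub>2 \<mu>\<^sub>3 = - \<mu>\<^sub>2 - 2 * \<mu>\<^sub>3"
    using nz by (simp_all add: coeff_a_def coeff_b_def coeff_c_def)
  have "(2 + \<mu>\<^sub>2) * (x ^ 3 + coeff_a \<mu>\<^sub>2 \<mu>\<^sub>3 * x\<^sup>2 + coeff_b \<mu>\<^sub>2 \<mu>\<^sub>3 * x + coeff_c \<mu>\<^sub>2 \<mu>\<^sub>3)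
    = (2 + \<mu>\<^sub>2) * x ^ 3 + (2 + \<mu>\<^sub>2) * coeff_a \<mu>\<^sub>2 \<mu>\<^sub>3 * x\<^sup>2
      + (2 + \<mu>\<^sub>2) * coeff_b \<mu>\<^sub>2 \<mu>\<^sub>3 * x + (2 + \<mu>\<^sub>2) * coeff_c \<mu>\<^sub>2 \<mu>\<^sub>3"
    by (simp only: distrib_left mult.assoc)
  then show ?thesis unfolding coeffs kite_cubic_def by simp
qed

lemma positive_roots_kite_cubic_monic:
  assumes "\<mu>\<^sub>2 \<noteq> -2"
  shows "positive_roots (kite_cubic \<mu>\<^sub>2 \<mu>\<^sub>3) = positive_roots
    (\<lambda>x. x ^ 3 + coeff_a \<mu>\<^sub>2 \<mu>\<^sub>3 * x\<^sup>2 + coeff_b \<mu>\<^sub>2 \<mu>\<^sub>3 * x + coeff_c \<mu>\<^sub>2 \<mu>\<^sub>3)"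
  by (rule positive_roots_scaleI[OF kite_cubic_monic[OF assms]]) (use assms in auto)

lemma Delta_eq_cubic_discriminant:
  "Delta \<mu>\<^sub>2 \<mu>\<^sub>3 = cubic_discriminant (coeff_a \<mu>\<^sub>2 \<mu>\<^sub>3) (coeff_b \<mu>\<^sub>2 \<mu>\<^sub>3) (coeff_c \<mu>\<^sub>2 \<mu>\<^sub>3)"
  by (simp add: Delta_def cubic_discriminant_def Let_def)

text \<open>A monic cubic with positive constant coefficient may have no positive root at all; the monic
  kite cubic has two because it is negative somewhere. At the points \<open>1/3\<close> and \<open>3\<close>,
  where \<open>cos t\<close> is \<open>-1/2\<close> and \<open>1/2\<close>, the unnormalised cubic has the sign of \<open>\<mu>\<^sub>2 - 1\<close> and of
  \<open>\<mu>\<^sub>3 - \<mu>\<^sub>2\<close>, and one of these signs is opposite to that of \<open>2 + \<mu>\<^sub>2\<close>.\<close>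

lemma card_kite_cubic_roots_c_pos:
  assumes m: "\<mu>\<^sub>2 \<noteq> -2" and c: "coeff_c \<mu>\<^sub>2 \<mu>\<^sub>3 > 0"
  shows "card (positive_roots (kite_cubic \<mu>\<^sub>2 \<mu>\<^sub>3)) = 2"
proof -
  have third: "kite_cubic \<mu>\<^sub>2 \<mu>\<^sub>3 (1/3) = 64 / 27 * (\<mu>\<^sub>2 - 1)"
    and three: "kite_cubic \<mu>\<^sub>2 \<mu>\<^sub>3 3 = 64 * (\<mu>\<^sub>3 - \<mu>\<^sub>2)"
    by (simp_all add: kite_cubic_def power2_eq_square power3_eq_cube field_simps)
  have "\<exists>y>0. (2 + \<mu>\<^sub>2) * kite_cubic \<mu>\<^sub>2 \<mu>\<^sub>3 y < 0"
  proof (cases "2 + \<mu>\<^sub>2 > 0")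
    case True
    then have *: "\<mu>\<^sub>2 + 2 * \<mu>\<^sub>3 < 0" using c by (simp add: coeff_c_def field_simps)
    show ?thesis
    proof (cases "\<mu>\<^sub>2 < 1")
      case True
      with \<open>2 + \<mu>\<^sub>2 > 0\<close> show ?thesis
        by (intro exI[of _ "1/3"]) (simp add: third mult_pos_neg)
    next
      case False
      with \<open>2 + \<mu>\<^sub>2 > 0\<close> * show ?thesis
        by (intro exI[of _ 3]) (simp add: three mult_pos_neg)
    qed
  next
    case False
    then have neg: "2 + \<mu>\<^sub>2 < 0" using m by linarith
    then have "\<mu>\<^sub>2 + 2 * \<mu>\<^sub>3 > 0" using c by (simp add: coeff_c_def field_simps)
    with neg show ?thesis by (intro exI[of _ 3]) (simp add: three mult_neg_pos)
  qed
  then obtain y where y: "y > 0" "(2 + \<mu>\<^sub>2) * kite_cubic \<mu>\<^sub>2 \<mu>\<^sub>3 y < 0" by blast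
  have "(2 + \<mu>\<^sub>2) * ((2 + \<mu>\<^sub>2) * z) < 0 \<longleftrightarrow> z < 0" for z
    using m by (auto simp: mult_less_0_iff zero_less_mult_iff)
  then have "y ^ 3 + coeff_a \<mu>\<^sub>2 \<mu>\<^sub>3 * y\<^sup>2 + coeff_b \<mu>\<^sub>2 \<mu>\<^sub>3 * y + coeff_c \<mu>\<^sub>2 \<mu>\<^sub>3 < 0"
    using y(2) unfolding kite_cubic_monic[OF m] by blast
  then show ?thesis
    unfolding positive_roots_kite_cubic_monic[OF m]
    by (rule card_positive_roots_cubic_pos[OF c y(1)])
qed

text \<open>When the constant coefficient vanishes, the root \<open>x = 0\<close> is the collision \<open>t = pi\<close> and
  splits off; the remaining quadratic has discriminant a sum of squares over a square, so the
  sign of \<open>coeff_b\<close> decides. The same discriminant shows that \<open>Delta\<close> vanishes here only together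
  with \<open>coeff_b\<close>, so the double-root part of the two-kite region does not meet \<open>coeff_c = 0\<close>.\<close>

lemma card_kite_cubic_roots_c_zero:
  assumes m: "\<mu>\<^sub>2 \<noteq> -2" and c: "coeff_c \<mu>\<^sub>2 \<mu>\<^sub>3 = 0"
  shows "card (positive_roots (kite_cubic \<mu>\<^sub>2 \<mu>\<^sub>3)) = (if \<mu>\<^sub>2 < -2 \<or> \<mu>\<^sub>2 > 6/13 then 2 else 1)"
    and "\<not> (Delta \<mu>\<^sub>2 \<mu>\<^sub>3 = 0 \<and> coeff_a \<mu>\<^sub>2 \<mu>\<^sub>3 * coeff_b \<mu>\<^sub>2 \<mu>\<^sub>3 - 9 * coeff_c \<mu>\<^sub>2 \<mu>\<^sub>3 < 0)"
proof -
  define a where "a = coeff_a \<mu>\<^sub>2 \<mu>\<^sub>3"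
  define b where "b = coeff_b \<mu>\<^sub>2 \<mu>\<^sub>3"
  have nz: "2 + \<mu>\<^sub>2 \<noteq> 0" using m by linarith
  have \<mu>\<^sub>3: "\<mu>\<^sub>3 = - \<mu>\<^sub>2 / 2" using c nz by (simp add: coeff_c_def)
  have a: "a = - (18 * \<mu>\<^sub>2 + 4) / (2 + \<mu>\<^sub>2)" and b: "b = (13 * \<mu>\<^sub>2 - 6) / (2 + \<mu>\<^sub>2)"
    unfolding a_def b_def coeff_a_def coeff_b_def \<mu>\<^sub>3 by (simp_all add: field_simps)
  have "a\<^sup>2 - 4 * b = ((18 * \<mu>\<^sub>2 + 4)\<^sup>2 - 4 * (13 * \<mu>\<^sub>2 - 6) * (2 + \<mu>\<^sub>2)) / (2 + \<mu>\<^sub>2)\<^sup>2"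
    unfolding a b using nz
    by (simp add: power_divide power2_eq_square divide_simps) (simp add: algebra_simps)
  also have "(18 * \<mu>\<^sub>2 + 4)\<^sup>2 - 4 * (13 * \<mu>\<^sub>2 - 6) * (2 + \<mu>\<^sub>2) = 256 * \<mu>\<^sub>2\<^sup>2 + 16 * (2 + \<mu>\<^sub>2)\<^sup>2"
    by (simp add: power2_eq_square algebra_simps)
  also have "\<dots> / (2 + \<mu>\<^sub>2)\<^sup>2 > 0"
    using nz by (intro divide_pos_pos add_nonneg_pos) auto
  finally have disc: "a\<^sup>2 > 4 * b" by simp
  have b_pos: "b > 0 \<longleftrightarrow> \<mu>\<^sub>2 < -2 \<or> \<mu>\<^sub>2 > 6/13"
    unfolding b by (auto simp: zero_less_divide_iff)
  have a_neg: "a < 0" if "b \<ge> 0"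
    using that nz unfolding a b by (auto simp: divide_less_0_iff zero_le_divide_iff)
  have "positive_roots (kite_cubic \<mu>\<^sub>2 \<mu>\<^sub>3) = positive_roots (\<lambda>x. x\<^sup>2 + a * x + b)"
    unfolding positive_roots_kite_cubic_monic[OF m] c a_def[symmetric] b_def[symmetric]
    by (rule positive_roots_scaleI[where r = "\<lambda>x. x"])
       (auto simp: power2_eq_square power3_eq_cube algebra_simps)
  then show "card (positive_roots (kite_cubic \<mu>\<^sub>2 \<mu>\<^sub>3)) = (if \<mu>\<^sub>2 < -2 \<or> \<mu>\<^sub>2 > 6/13 then 2 else 1)"
    using card_positive_roots_quadratic[of b a] disc a_neg b_pos[symmetric]
    by (cases b "0 :: real" rule: linorder_cases) auto
  have "Delta \<mu>\<^sub>2 \<mu>\<^sub>3 = b\<^sup>2 * (a\<^sup>2 - 4 * b)"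
    unfolding Delta_eq_cubic_discriminant cubic_discriminant_def c a_def[symmetric] b_def[symmetric]
    by (simp add: power2_eq_square power3_eq_cube algebra_simps)
  then have "b = 0" if "Delta \<mu>\<^sub>2 \<mu>\<^sub>3 = 0" using that disc by auto
  then show "\<not> (Delta \<mu>\<^sub>2 \<mu>\<^sub>3 = 0 \<and> coeff_a \<mu>\<^sub>2 \<mu>\<^sub>3 * coeff_b \<mu>\<^sub>2 \<mu>\<^sub>3 - 9 * coeff_c \<mu>\<^sub>2 \<mu>\<^sub>3 < 0)"
    unfolding c a_def[symmetric] b_def[symmetric] by auto
qed

text \<open>For \<open>\<mu>\<^sub>2 = -2\<close> the cubic term disappears, a root having escaped to infinity, that is,
  to the collision \<open>t = 0\<close>. At \<open>\<mu>\<^sub>3 = -13/3\<close> the quadratic term disappears as well.\<close>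

lemma card_kite_cubic_roots_degenerate:
  "card (positive_roots (kite_cubic (-2) \<mu>\<^sub>3)) = (if -13/3 < \<mu>\<^sub>3 \<and> \<mu>\<^sub>3 < 1 then 2 else 1)"
proof (cases "\<mu>\<^sub>3 = -13/3")
  case True
  have root: "kite_cubic (-2) \<mu>\<^sub>3 x = 0 \<longleftrightarrow> x = 1/5" for x
  proof -
    have "3 * kite_cubic (-2) \<mu>\<^sub>3 x = 32 - 160 * x" unfolding True kite_cubic_def by simp
    then show ?thesis by linarith
  qed
  have roots: "positive_roots (kite_cubic (-2) \<mu>\<^sub>3) = {1/5}"
    unfolding positive_roots_def root by auto
  show ?thesis unfolding roots using True by simp
next
  case False
  define l where "l = 6 * \<mu>\<^sub>3 + 26"
  have nz: "l \<noteq> 0" using False by (simp add: l_def)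
  define a where "a = (4 * \<mu>\<^sub>3 - 36) / l"
  define b where "b = (2 - 2 * \<mu>\<^sub>3) / l"
  have "kite_cubic (-2) \<mu>\<^sub>3 x = l * (x\<^sup>2 + a * x + b)" for x
  proof -
    have "l * (x\<^sup>2 + a * x + b) = l * x\<^sup>2 + (4 * \<mu>\<^sub>3 - 36) * x + (2 - 2 * \<mu>\<^sub>3)"
      using nz by (simp add: a_def b_def distrib_left)
    then show ?thesis by (simp add: kite_cubic_def l_def algebra_simps)
  qed
  then have roots: "positive_roots (kite_cubic (-2) \<mu>\<^sub>3) = positive_roots (\<lambda>x. x\<^sup>2 + a * x + b)"
    using nz by (intro positive_roots_scaleI[where r = "\<lambda>_. l"]) auto
  have "a\<^sup>2 - 4 * b = ((4 * \<mu>\<^sub>3 - 36)\<^sup>2 - 4 * (2 - 2 * \<mu>\<^sub>3) * l) / l\<^sup>2"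
    unfolding a_def b_def using nz by (simp add: power_divide power2_eq_square divide_simps)
  also have "(4 * \<mu>\<^sub>3 - 36)\<^sup>2 - 4 * (2 - 2 * \<mu>\<^sub>3) * l = 64 * (\<mu>\<^sub>3 - 1)\<^sup>2 + 1024"
    by (simp add: l_def power2_eq_square algebra_simps)
  also have "\<dots> / l\<^sup>2 > 0"
    using nz by (intro divide_pos_pos add_nonneg_pos) auto
  finally have disc: "a\<^sup>2 > 4 * b" by simp
  have b_pos: "b > 0 \<longleftrightarrow> -13/3 < \<mu>\<^sub>3 \<and> \<mu>\<^sub>3 < 1"
    unfolding b_def l_def by (auto simp: zero_less_divide_iff)
  have a_neg: "a < 0" if "b \<ge> 0"
    using that nz unfolding a_def b_def l_def by (auto simp: divide_less_0_iff zero_le_divide_iff)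
  show ?thesis
    using card_positive_roots_quadratic[of b a] disc a_neg b_pos[symmetric] unfolding roots
    by (cases b "0 :: real" rule: linorder_cases) auto
qed

lemma card_positive_roots_kite_cubic:
  "card (positive_roots (kite_cubic \<mu>\<^sub>2 \<mu>\<^sub>3)) =
    (if (\<mu>\<^sub>2, \<mu>\<^sub>3) \<in> three_kites_region then 3
     else if (\<mu>\<^sub>2, \<mu>\<^sub>3) \<in> two_kites_region then 2 else 1)"
proof (cases "\<mu>\<^sub>2 = -2")
  case True
  then show ?thesis
    using card_kite_cubic_roots_degenerate[of \<mu>\<^sub>3]
    by (simp add: three_kites_region_def two_kites_region_def)
next
  case m: False
  show ?thesis
  proof (cases "coeff_c \<mu>\<^sub>2 \<mu>\<^sub>3" "0 :: real" rule: linorder_cases)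
    case less
    then show ?thesis
      unfolding positive_roots_kite_cubic_monic[OF m]
      using card_positive_roots_cubic_neg[OF less, of "coeff_a \<mu>\<^sub>2 \<mu>\<^sub>3" "coeff_b \<mu>\<^sub>2 \<mu>\<^sub>3"] m
      by (simp add: three_kites_region_def two_kites_region_def Delta_eq_cubic_discriminant)
  next
    case equal
    then show ?thesis
      using card_kite_cubic_roots_c_zero[OF m equal] m
      by (simp add: three_kites_region_def two_kites_region_def)
  next
    case greater
    then show ?thesis
      using card_kite_cubic_roots_c_pos[OF m greater] m
      by (simp add: three_kites_region_def two_kites_region_def)
  qed
qed

lemma three_and_two_kites_regions_disjoint: "three_kites_region \<inter> two_kites_region = {}"
  by (auto simp: three_kites_region_def two_kites_region_def)

theorem theorem11:
  fixes \<mu> :: "real ^ 4"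
  assumes nonzero: "\<forall>i. \<mu> $ i \<noteq> 0"
    and symmetric: "\<mu> $ 2 = \<mu> $ 4"
  shows "kite_configurations \<mu> \<noteq> {} \<and>
    (\<forall>k \<mu>\<^sub>2 \<mu>\<^sub>3. k \<noteq> 0 \<and> \<mu> = k *\<^sub>R vector [1, \<mu>\<^sub>2, \<mu>\<^sub>3, \<mu>\<^sub>2] \<longrightarrow>
      ((\<mu>\<^sub>2, \<mu>\<^sub>3) \<in> three_kites_region \<longrightarrow> card (kite_configurations \<mu>) = 3) \<and>
      ((\<mu>\<^sub>2, \<mu>\<^sub>3) \<in> two_kites_region \<longrightarrow> card (kite_configurations \<mu>) = 2) \<and>
      ((\<mu>\<^sub>2, \<mu>\<^sub>3) \<notin> three_kites_region \<union> two_kites_region \<longrightarrow> card (kite_configurations \<mu>) = 1))"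
proof -
  have count: "card (kite_configurations \<mu>) =
      (if (\<mu>\<^sub>2, \<mu>\<^sub>3) \<in> three_kites_region then 3
       else if (\<mu>\<^sub>2, \<mu>\<^sub>3) \<in> two_kites_region then 2 else 1)"
    if k: "k \<noteq> 0" and \<mu>: "\<mu> = k *\<^sub>R vector [1, \<mu>\<^sub>2, \<mu>\<^sub>3, \<mu>\<^sub>2]" for k \<mu>\<^sub>2 \<mu>\<^sub>3
  proof -
    have "\<mu>\<^sub>2 \<noteq> 0" using nonzero[rule_format, of 2] unfolding \<mu> by (simp add: vector_4)
    show ?thesis
      unfolding \<mu> card_kite_configurations[OF k \<open>\<mu>\<^sub>2 \<noteq> 0\<close>] by (rule card_positive_roots_kite_cubic)
  qed
  have "\<mu> = \<mu> $ 1 *\<^sub>R vector [1, \<mu> $ 2 / \<mu> $ 1, \<mu> $ 3 / \<mu> $ 1, \<mu> $ 2 / \<mu> $ 1]"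
    using nonzero symmetric by (simp add: vec_eq_iff forall_4 vector_4)
  from count[OF _ this] have "card (kite_configurations \<mu>) \<noteq> 0"
    using nonzero by (simp split: if_splits)
  then have "kite_configurations \<mu> \<noteq> {}" by auto
  then show ?thesis using count three_and_two_kites_regions_disjoint by auto
qed

end
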